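(* Let $X$ be a locally finite poset and $K$ a field. Let $\sigma\in I(X,K)$ be multiplicative, let $\lambda\in\mathrm{Aut}(X)$, and let $\psi=M_\sigma\circ\hat\lambda\in\mathrm{Aut}(I(X,K))$. Then $$\mathrm{Der}^{\psi}(I(X,K))=\mathrm{IDer}^{\psi}(I(X,K))+\mathrm{ADer}^{\psi}(I(X,K)).$$
   Context: A poset is locally finite if all its intervals $\{z: x\le z\le y\}$ are finite. $\mathrm{Aut}(X)$ is the group of bijections $\lambda:X\to X$ with $x\le y\iff\lambda(x)\le\lambda(y)$. The incidence algebra $I(X,K)$ is the $K$-space of functions $f:X\times X\to K$ with $f(x,y)=0$ for $x\nleq y$, with product $(fg)(x,y)=\sum_{x\le z\le y}f(x,z)g(z,y)$; it is associative and unital. An element $\sigma\in I(X,K)$ is multiplicative if $\sigma(x,y)\ne 0$ for all $x\le y$ and $\sigma(x,z)=\sigma(x,y)\sigma(y,z)$ whenever $x\le y\le z$; it determines the automorphism $M_\sigma$ of $I(X,K)$, $M_\sigma(f)(x,y)=\sigma(x,y)f(x,y)$. Each $\lambda\in\mathrm{Aut}(X)$ induces the automorphism $\hat\lambda$ of $I(X,K)$, $\hat\lambda(f)(x,y)=f(\lambda^{-1}(x),\lambda^{-1}(y))$. For a $K$-algebra $A$ and $\psi\in\mathrm{Aut}(A)$, a $\psi$-derivation of $A$ is a linear map $d:A\to A$ with $d(ab)=d(a)b+\psi(a)d(b)$ for all $a,b\in A$; $\mathrm{Der}^{\psi}(A)$ is the $K$-space of all of them. If $A$ is associative, then for $a\in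 A$ the map $D^\psi_a(b)=ab-\psi(b)a$ is an inner $\psi$-derivation; $\mathrm{IDer}^{\psi}(A)$ is the subspace of all inner $\psi$-derivations. An element $\tau\in I(X,K)$ is $(\sigma,\lambda)$-additive if $\tau(x,y)=0$ whenever $\lambda(x)\nleq y$, and $\tau(x,z)=\tau(x,y)+\sigma(\lambda(x),\lambda(y))\tau(y,z)$ for all $x\le y\le z$. For such $\tau$, the map $L_\tau:I(X,K)\to I(X,K)$ is defined by $L_\tau(f)(\lambda(x),y)=\tau(x,y)f(x,y)$ for all $f\in I(X,K)$, $x,y\in X$. A $\psi$-derivation $d$ (with $\psi=M_\sigma\circ\hat\lambda$) is additive if $d=L_\tau$ for some $(\sigma,\lambda)$-additive $\tau$; $\mathrm{ADer}^{\psi}(I(X,K))$ is the set of all additive $\psi$-derivations (a $K$-subspace of $\mathrm{Der}^{\psi}(I(X,K))$). *)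

theory Defs
  imports Complex_Main "HOL-Library.Set_Algebras" "HOL-Library.Function_Algebras"
begin

section \<open>Locally finite posets and their automorphisms\<close>

class locally_finite_order = order +
  assumes finite_interval: "finite {z. x \<le> z \<and> z \<le> y}"

definition poset_Aut :: "('x::order \<Rightarrow> 'x) set" where
  "poset_Aut = {l. bij l \<and> (\<forall>x y. x \<le> y \<longleftrightarrow> l x \<le> l y)}"

lemma poset_Aut_inv_le:
  assumes "l \<in> poset_Aut"
  shows "inv l x \<le> inv l y \<longleftrightarrow> x \<le> y"
proof -
  have "surj l" and le: "\<And>x y. x \<le> y \<longleftrightarrow> l x \<le> l y"
    using assms by (auto simp: poset_Aut_def bij_is_surj)
  then show ?thesis using le[of "inv l x" "inv l y"] by (simp add: surj_f_inv_f)
qed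


section \<open>The incidence algebra\<close>

typedef (overloaded) ('x::order, 'k::zero) incidence_algebra =
    "{f :: 'x \<Rightarrow> 'x \<Rightarrow> 'k. \<forall>x y. \<not> x \<le> y \<longrightarrow> f x y = 0}"
  morphisms inc_apply Inc
  by (rule exI[of _ "\<lambda>_ _. 0"]) simp

setup_lifting type_definition_incidence_algebra

lemma inc_apply_outside: "\<not> x \<le> y \<Longrightarrow> inc_apply f x y = 0"
  by transfer simp

lemma inc_eqI: "(\<And>x y. x \<le> y \<Longrightarrow> inc_apply f x y = inc_apply g x y) \<Longrightarrow> f = g"
proof -
  assume eq: "\<And>x y. x \<le> y \<Longrightarrow> inc_apply f x y = inc_apply g x y"
  have "inc_apply f x y = inc_apply g x y" for x y
    using eq by (cases "x \<le> y") (simp_all add: inc_apply_outside)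
  then have "inc_apply f = inc_apply g" by (simp add: fun_eq_iff)
  then show "f = g" by (simp add: inc_apply_inject)
qed

instantiation incidence_algebra :: (order, ab_group_add) ab_group_add
begin

lift_definition zero_incidence_algebra :: "('a, 'b) incidence_algebra" is "\<lambda>_ _. 0" by simp

lift_definition plus_incidence_algebra ::
    "('a, 'b) incidence_algebra \<Rightarrow> ('a, 'b) incidence_algebra \<Rightarrow> ('a, 'b) incidence_algebra"
  is "\<lambda>f g x y. f x y + g x y" by simp

lift_definition minus_incidence_algebra ::
    "('a, 'b) incidence_algebra \<Rightarrow> ('a, 'b) incidence_algebra \<Rightarrow> ('a, 'b) incidence_algebra"
  is "\<lambda>f g x y. f x y - g x y" by simp

lift_definition uminus_incidence_algebra ::
    "('a, 'b) incidence_algebra \<Rightarrow> ('a, 'b) incidence_algebra"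
  is "\<lambda>f x y. - f x y" by simp

instance by standard (transfer; simp add: fun_eq_iff algebra_simps)+

end

lift_definition inc_scale ::
    "'k::field \<Rightarrow> ('x::order, 'k) incidence_algebra \<Rightarrow> ('x, 'k) incidence_algebra"
  is "\<lambda>c f x y. c * f x y" by simp

instantiation incidence_algebra :: (locally_finite_order, field) ring_1
begin

lift_definition one_incidence_algebra :: "('a, 'b) incidence_algebra"
  is "\<lambda>x y. if x = y then 1 else 0" by auto

lift_definition times_incidence_algebra ::
    "('a, 'b) incidence_algebra \<Rightarrow> ('a, 'b) incidence_algebra \<Rightarrow> ('a, 'b) incidence_algebra"
  is "\<lambda>f g x y. \<Sum>z | x \<le> z \<and> z \<le> y. f x z * g z y"
  by (auto intro!: sum.neutral)

instance
proof
  fix a b c :: "('a, 'b) incidence_algebra"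
  show "a * b * c = a * (b * c)"
  proof (rule inc_eqI)
    fix x y :: 'a
    have "inc_apply (a * b * c) x y =
        (\<Sum>z | x \<le> z \<and> z \<le> y. \<Sum>w | w \<in> {w. x \<le> w \<and> w \<le> y} \<and> w \<le> z.
            inc_apply a x w * (inc_apply b w z * inc_apply c z y))"
      unfolding times_incidence_algebra.rep_eq sum_distrib_right
      by (intro sum.cong refl) (auto simp: mult.assoc)
    also have "\<dots> = (\<Sum>w | x \<le> w \<and> w \<le> y. \<Sum>z | z \<in> {z. x \<le> z \<and> z \<le> y} \<and> w \<le> z.
            inc_apply a x w * (inc_apply b w z * inc_apply c z y))"
      by (rule sum.swap_restrict) (rule finite_interval)+
    also have "\<dots> = inc_apply (a * (b * c)) x y"
      unfolding times_incidence_algebra.rep_eq sum_distrib_left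
      by (intro sum.cong refl) auto
    finally show "inc_apply (a * b * c) x y = inc_apply (a * (b * c)) x y" .
  qed
  show "1 * a = a"
  proof (rule inc_eqI)
    fix x y :: 'a
    assume "x \<le> y"
    then show "inc_apply (1 * a) x y = inc_apply a x y"
      by (simp add: times_incidence_algebra.rep_eq one_incidence_algebra.rep_eq finite_interval
          if_distrib[of "\<lambda>u. u * _"] sum.delta' cong: if_cong)
  qed
  show "a * 1 = a"
  proof (rule inc_eqI)
    fix x y :: 'a
    assume "x \<le> y"
    then show "inc_apply (a * 1) x y = inc_apply a x y"
      by (simp add: times_incidence_algebra.rep_eq one_incidence_algebra.rep_eq finite_interval
          if_distrib[of "\<lambda>u. _ * u"] sum.delta cong: if_cong)
  qed
  show "(a + b) * c = a * c + b * c"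
    by (rule inc_eqI) (simp add: times_incidence_algebra.rep_eq plus_incidence_algebra.rep_eq
        sum.distrib algebra_simps)
  show "a * (b + c) = a * b + a * c"
    by (rule inc_eqI) (simp add: times_incidence_algebra.rep_eq plus_incidence_algebra.rep_eq
        sum.distrib algebra_simps)
  have "inc_apply (0 :: ('a, 'b) incidence_algebra) x x \<noteq> inc_apply 1 x x" for x
    by (simp add: zero_incidence_algebra.rep_eq one_incidence_algebra.rep_eq)
  then show "(0 :: ('a, 'b) incidence_algebra) \<noteq> 1" by metis
qed

end

lemma vector_space_inc_scale:
  "vector_space (inc_scale :: 'k::field \<Rightarrow> ('x::order, 'k) incidence_algebra \<Rightarrow> _)"
  by standard (transfer; simp add: fun_eq_iff algebra_simps)+

lemma inc_scale_mult:
  fixes a b :: "('x::locally_finite_order, 'k::field) incidence_algebra"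
  shows "inc_scale c a * b = inc_scale c (a * b)" "a * inc_scale c b = inc_scale c (a * b)"
  by (rule inc_eqI, simp add: times_incidence_algebra.rep_eq inc_scale.rep_eq sum_distrib_left
      algebra_simps)+


section \<open>Twisted derivations of an algebra\<close>

text \<open>A \<open>K\<close>-algebra is given by an associative unital ring type \<open>'a\<close> together with its scalar
  multiplication \<open>scale\<close>; \<^const>\<open>Vector_Spaces.linear\<close> contains the vector space axioms.\<close>

definition algebra_Aut :: "('k::field \<Rightarrow> 'a::ring_1 \<Rightarrow> 'a) \<Rightarrow> ('a \<Rightarrow> 'a) set" where
  "algebra_Aut scale = {psi. bij psi \<and> Vector_Spaces.linear scale scale psi \<and>
     psi 1 = 1 \<and> (\<forall>a b. psi (a * b) = psi a * psi b)}"

definition Der :: "('k::field \<Rightarrow> 'a::ring_1 \<Rightarrow> 'a) \<Rightarrow> ('a \<Rightarrow> 'a) \<Rightarrow> ('a \<Rightarrow> 'a) set" where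
  "Der scale psi = {d. Vector_Spaces.linear scale scale d \<and>
     (\<forall>a b. d (a * b) = d a * b + psi a * d b)}"

definition inner_der :: "('a::ring_1 \<Rightarrow> 'a) \<Rightarrow> 'a \<Rightarrow> 'a \<Rightarrow> 'a" where
  "inner_der psi a = (\<lambda>b. a * b - psi b * a)"

definition IDer :: "('a::ring_1 \<Rightarrow> 'a) \<Rightarrow> ('a \<Rightarrow> 'a) set" where
  "IDer psi = {inner_der psi a | a. True}"


section \<open>Multiplicative automorphisms, poset automorphisms, additive derivations\<close>

definition multiplicative :: "('x::order, 'k::field) incidence_algebra \<Rightarrow> bool" where
  "multiplicative s \<longleftrightarrow> (\<forall>x y. x \<le> y \<longrightarrow> inc_apply s x y \<noteq> 0) \<and>
     (\<forall>x y z. x \<le> y \<and> y \<le> z \<longrightarrow> inc_apply s x z = inc_apply s x y * inc_apply s y z)"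

lift_definition mult_aut ::
    "('x::order, 'k::field) incidence_algebra \<Rightarrow> ('x, 'k) incidence_algebra \<Rightarrow> ('x, 'k) incidence_algebra"
  is "\<lambda>s f x y. s x y * f x y" by simp

text \<open>The right-hand side lies in the incidence algebra only when \<open>l\<close> is a poset automorphism;
  otherwise the value of \<open>Inc\<close> is meaningless.  The same applies to \<open>L_map\<close> below, which requires
  \<open>t\<close> to be additive.\<close>

definition hat :: "('x::order \<Rightarrow> 'x) \<Rightarrow> ('x, 'k::field) incidence_algebra \<Rightarrow> ('x, 'k) incidence_algebra" where
  "hat l f = Inc (\<lambda>x y. inc_apply f (inv l x) (inv l y))"

lemma inc_apply_hat:
  assumes "l \<in> poset_Aut"
  shows "inc_apply (hat l f) x y = inc_apply f (inv l x) (inv l y)"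
  unfolding hat_def
  by (subst Inc_inverse) (auto simp: poset_Aut_inv_le[OF assms] inc_apply_outside)

definition additive_elem ::
    "('x::order, 'k::field) incidence_algebra \<Rightarrow> ('x \<Rightarrow> 'x) \<Rightarrow> ('x, 'k) incidence_algebra \<Rightarrow> bool" where
  "additive_elem s l t \<longleftrightarrow> (\<forall>x y. \<not> l x \<le> y \<longrightarrow> inc_apply t x y = 0) \<and>
     (\<forall>x y z. x \<le> y \<and> y \<le> z \<longrightarrow>
        inc_apply t x z = inc_apply t x y + inc_apply s (l x) (l y) * inc_apply t y z)"

definition L_map ::
    "('x::order \<Rightarrow> 'x) \<Rightarrow> ('x, 'k::field) incidence_algebra \<Rightarrow>
     ('x, 'k) incidence_algebra \<Rightarrow> ('x, 'k) incidence_algebra" where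
  "L_map l t f = Inc (\<lambda>u y. inc_apply t (inv l u) y * inc_apply f (inv l u) y)"

lemma inc_apply_L_map:
  assumes "l \<in> poset_Aut" "additive_elem s l t"
  shows "inc_apply (L_map l t f) (l x) y = inc_apply t x y * inc_apply f x y"
proof -
  have l: "bij l" using assms(1) by (simp add: poset_Aut_def)
  have "inc_apply t (inv l u) v = 0" if "\<not> u \<le> v" for u v
    using assms(2) that bij_is_surj[OF l] unfolding additive_elem_def by (metis surj_f_inv_f)
  then show ?thesis
    unfolding L_map_def
    by (subst Inc_inverse) (auto simp: inv_f_f[OF bij_is_inj[OF l]])
qed

definition ADer ::
    "('x::locally_finite_order, 'k::field) incidence_algebra \<Rightarrow> ('x \<Rightarrow> 'x) \<Rightarrow>
     (('x, 'k) incidence_algebra \<Rightarrow> ('x, 'k) incidence_algebra) set" where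
  "ADer s l = {d \<in> Der inc_scale (mult_aut s \<circ> hat l). \<exists>t. additive_elem s l t \<and> d = L_map l t}"

lemma inc_linearI:
  fixes F :: "('x::order, 'k::field) incidence_algebra \<Rightarrow> ('x, 'k) incidence_algebra"
  assumes "\<And>a b. F (a + b) = F a + F b" "\<And>c a. F (inc_scale c a) = inc_scale c (F a)"
  shows "Vector_Spaces.linear inc_scale inc_scale F"
  using assms by (simp add: Vector_Spaces.linear_iff vector_space_inc_scale)

lemma mult_aut_in_Aut:
  fixes s :: "('x::locally_finite_order, 'k::field) incidence_algebra"
  assumes "multiplicative s"
  shows "mult_aut s \<in> algebra_Aut inc_scale"
proof -
  have nz: "x \<le> y \<Longrightarrow> inc_apply s x y \<noteq> 0"
    and m: "x \<le> y \<Longrightarrow> y \<le> z \<Longrightarrow> inc_apply s x z = inc_apply s x y * inc_apply s y z" for x y z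
    using assms unfolding multiplicative_def by blast+
  have s1: "inc_apply s x x = 1" for x using nz[of x x] m[of x x x] by simp
  define r where "r = Inc (\<lambda>x y. inverse (inc_apply s x y))"
  have r: "inc_apply r x y = inverse (inc_apply s x y)" for x y
    unfolding r_def by (subst Inc_inverse) (auto simp: inc_apply_outside)
  have "mult_aut r \<circ> mult_aut s = id" "mult_aut s \<circ> mult_aut r = id"
    by (auto simp: fun_eq_iff mult_aut.rep_eq r nz intro!: inc_eqI)
  then have "bij (mult_aut s)" by (rule o_bij)
  moreover have "Vector_Spaces.linear inc_scale inc_scale (mult_aut s)"
    by (rule inc_linearI; rule inc_eqI)
      (auto simp: mult_aut.rep_eq plus_incidence_algebra.rep_eq inc_scale.rep_eq algebra_simps)
  moreover have "mult_aut s 1 = 1"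
    by (rule inc_eqI) (simp add: mult_aut.rep_eq one_incidence_algebra.rep_eq s1)
  moreover have "mult_aut s (a * b) = mult_aut s a * mult_aut s b" for a b
  proof (rule inc_eqI)
    fix x y :: 'x
    have "inc_apply s x y * (inc_apply a x z * inc_apply b z y) =
        inc_apply s x z * inc_apply a x z * (inc_apply s z y * inc_apply b z y)"
      if "x \<le> z \<and> z \<le> y" for z
      using m[of x z y] that by simp
    then show "inc_apply (mult_aut s (a * b)) x y = inc_apply (mult_aut s a * mult_aut s b) x y"
      by (auto simp: mult_aut.rep_eq times_incidence_algebra.rep_eq sum_distrib_left
          intro!: sum.cong)
  qed
  ultimately show ?thesis unfolding algebra_Aut_def by blast
qed

lemma hat_in_Aut:
  fixes l :: "'x::locally_finite_order \<Rightarrow> 'x"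
  assumes l: "l \<in> poset_Aut"
  shows "(hat l :: ('x, 'k::field) incidence_algebra \<Rightarrow> _) \<in> algebra_Aut inc_scale"
proof -
  have b: "bij l" and le: "\<And>x y. l x \<le> l y \<longleftrightarrow> x \<le> y" using l by (auto simp: poset_Aut_def)
  have bi: "bij (inv l)" using b by (rule bij_imp_bij_inv)
  have li: "inv l \<in> poset_Aut" using bi poset_Aut_inv_le[OF l] by (simp add: poset_Aut_def)
  have inj: "inv l x = inv l y \<longleftrightarrow> x = y" for x y using bij_is_inj[OF bi] by (rule inj_eq)
  have "hat (inv l) \<circ> hat l = (id :: ('x, 'k) incidence_algebra \<Rightarrow> _)"
    "hat l \<circ> hat (inv l) = (id :: ('x, 'k) incidence_algebra \<Rightarrow> _)"
    by (auto simp: fun_eq_iff inc_apply_hat[OF l] inc_apply_hat[OF li] inv_inv_eq[OF b]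
        inv_f_f[OF bij_is_inj[OF b]] surj_f_inv_f[OF bij_is_surj[OF b]] intro!: inc_eqI)
  then have "bij (hat l :: ('x, 'k) incidence_algebra \<Rightarrow> _)" by (rule o_bij)
  moreover have "Vector_Spaces.linear inc_scale inc_scale (hat l :: ('x, 'k) incidence_algebra \<Rightarrow> _)"
    by (rule inc_linearI; rule inc_eqI)
      (auto simp: inc_apply_hat[OF l] plus_incidence_algebra.rep_eq inc_scale.rep_eq)
  moreover have "hat l 1 = (1 :: ('x, 'k) incidence_algebra)"
    by (rule inc_eqI) (simp add: inc_apply_hat[OF l] one_incidence_algebra.rep_eq inj)
  moreover have "hat l (f * g) = hat l f * hat l g" for f g :: "('x, 'k) incidence_algebra"
  proof (rule inc_eqI)
    fix x y :: 'x
    have "bij_betw (inv l) {z. x \<le> z \<and> z \<le> y} {z. inv l x \<le> z \<and> z \<le> inv l y}"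
      by (rule bij_betw_byWitness[where f' = l])
        (auto simp: poset_Aut_inv_le[OF l] surj_f_inv_f[OF bij_is_surj[OF b]]
          inv_f_f[OF bij_is_inj[OF b]], (metis b bij_inv_eq_iff le)+)
    from sum.reindex_bij_betw[OF this, of "\<lambda>z. inc_apply f (inv l x) z * inc_apply g z (inv l y)"]
    show "inc_apply (hat l (f * g)) x y = inc_apply (hat l f * hat l g) x y"
      by (simp add: inc_apply_hat[OF l] times_incidence_algebra.rep_eq)
  qed
  ultimately show ?thesis unfolding algebra_Aut_def by blast
qed

lemma algebra_Aut_comp:
  assumes "f \<in> algebra_Aut scale" "g \<in> algebra_Aut scale"
  shows "f \<circ> g \<in> algebra_Aut scale"
  using assms unfolding algebra_Aut_def
  by (auto intro: bij_comp Vector_Spaces.linear_compose)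

lemma psi_in_Aut:
  fixes s :: "('x::locally_finite_order, 'k::field) incidence_algebra"
  assumes "multiplicative s" "l \<in> poset_Aut"
  shows "mult_aut s \<circ> hat l \<in> algebra_Aut inc_scale"
  using assms by (intro algebra_Aut_comp mult_aut_in_Aut hat_in_Aut)

lemma IDer_subset_Der:
  fixes psi :: "('x::locally_finite_order, 'k::field) incidence_algebra \<Rightarrow> _"
  assumes "psi \<in> algebra_Aut inc_scale"
  shows "IDer psi \<subseteq> Der inc_scale psi"
proof -
  have mult: "\<And>a b. psi (a * b) = psi a * psi b"
    and lin: "Vector_Spaces.linear inc_scale inc_scale psi"
    using assms by (auto simp: algebra_Aut_def)
  interpret V: vector_space "inc_scale :: 'k \<Rightarrow> ('x, 'k) incidence_algebra \<Rightarrow> _"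
    by (rule vector_space_inc_scale)
  interpret P: Vector_Spaces.linear inc_scale inc_scale psi by (rule lin)
  show ?thesis
    by (auto simp: IDer_def Der_def inner_der_def mult P.add P.scale inc_scale_mult
        algebra_simps V.scale_right_diff_distrib intro!: inc_linearI)
qed

end

theory Submission
  imports Defs
begin

text \<open>
  Every diagonal idempotent \<open>e\<^sub>x\<close> is carried by \<open>psi\<close> to \<open>e\<^bsub>l x\<^esub>\<close>, because a multiplicative element
  takes the value 1 on the diagonal.  Applying a \<open>psi\<close>-derivation \<open>d\<close> to \<open>e\<^sub>x * e\<^sub>x = e\<^sub>x\<close> shows that
  \<open>d e\<^sub>x\<close> lives on row \<open>l x\<close> and column \<open>x\<close> and vanishes where the two meet; applying it to
  \<open>e\<^sub>x * e\<^sub>y = 0\<close> shows that the row of \<open>d e\<^sub>x\<close> is determined by the columns of the other \<open>d e\<^sub>y\<close>.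
  Hence the element \<open>a\<close> that collects all the columns, \<open>a(u,v) = (d e\<^sub>v)(u,v)\<close>, satisfies
  \<open>d e\<^sub>x = a * e\<^sub>x - psi e\<^sub>x * a\<close> for every \<open>x\<close> at once: up to an inner derivation, \<open>d\<close> kills all the
  \<open>e\<^sub>x\<close> (\<open>inner_der_agrees_on_idempotents\<close>).

  A \<open>psi\<close>-derivation killing the \<open>e\<^sub>x\<close> satisfies \<open>d (e\<^sub>x * f * e\<^sub>y) = e\<^bsub>l x\<^esub> * d f * e\<^sub>y\<close>.  As
  \<open>e\<^sub>x * f * e\<^sub>y\<close> is \<open>f(x,y)\<close> times a matrix unit, the entry of \<open>d f\<close> at \<open>(l x, y)\<close> is a fixed multiple
  \<open>t(x,y)\<close> of \<open>f(x,y)\<close>, and the product rule on matrix units says that \<open>t\<close> is additive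
  (\<open>Der_killing_idempotents_in_ADer\<close>).  Entries are isolated by multiplying with an idempotent on
  each side rather than by expanding \<open>f\<close> into matrix units, so infinite posets need no separate
  argument.
\<close>

section \<open>Matrix units\<close>

text \<open>The zero element is taken for incomparable indices, so that \<open>munit\<close> is total and the
  product formulas below carry a single side condition.\<close>

lift_definition munit :: "'x::order \<Rightarrow> 'x \<Rightarrow> ('x, 'k::field) incidence_algebra"
  is "\<lambda>x y u v. if u = x \<and> v = y \<and> x \<le> y then 1 else 0" by auto

lemma munit_times:
  fixes f :: "('x::locally_finite_order, 'k::field) incidence_algebra"
  shows "inc_apply (munit x y * f) u v = (if u = x \<and> x \<le> y then inc_apply f y v else 0)"
proof -
  have "inc_apply (munit x y * f) u v =
      (\<Sum>z | u \<le> z \<and> z \<le> v. if y = z then (if u = x \<and> x \<le> y then inc_apply f y v else 0) else 0)"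
    unfolding times_incidence_algebra.rep_eq by (intro sum.cong refl) (auto simp: munit.rep_eq)
  also have "\<dots> = (if u = x \<and> x \<le> y then inc_apply f y v else 0)"
    by (subst sum.delta') (auto simp: finite_interval inc_apply_outside)
  finally show ?thesis .
qed

lemma times_munit:
  fixes f :: "('x::locally_finite_order, 'k::field) incidence_algebra"
  shows "inc_apply (f * munit x y) u v = (if v = y \<and> x \<le> y then inc_apply f u x else 0)"
proof -
  have "inc_apply (f * munit x y) u v =
      (\<Sum>z | u \<le> z \<and> z \<le> v. if x = z then (if v = y \<and> x \<le> y then inc_apply f u x else 0) else 0)"
    unfolding times_incidence_algebra.rep_eq by (intro sum.cong refl) (auto simp: munit.rep_eq)
  also have "\<dots> = (if v = y \<and> x \<le> y then inc_apply f u x else 0)"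
    by (subst sum.delta') (auto simp: finite_interval inc_apply_outside)
  finally show ?thesis .
qed

lemma munit_sandwich:
  fixes f :: "('x::locally_finite_order, 'k::field) incidence_algebra"
  shows "munit x x * f * munit y y = inc_scale (inc_apply f x y) (munit x y)"
  by (rule inc_eqI) (auto simp: times_munit munit_times inc_scale.rep_eq munit.rep_eq inc_apply_outside)

lemma munit_mult:
  assumes "x \<le> y" "y \<le> z"
  shows "(munit x y * munit y z :: ('x::locally_finite_order, 'k::field) incidence_algebra) = munit x z"
  using assms by (intro inc_eqI) (auto simp: munit_times munit.rep_eq)

lemma munit_diag_mult:
  "(munit x x * munit y y :: ('x::locally_finite_order, 'k::field) incidence_algebra)
    = (if x = y then munit x x else 0)"
  by (rule inc_eqI) (auto simp: munit_times munit.rep_eq zero_incidence_algebra.rep_eq)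

lemma multiplicative_diag:
  assumes "multiplicative s"
  shows "inc_apply s x x = 1"
proof -
  have "inc_apply s x x \<noteq> 0" "inc_apply s x x = inc_apply s x x * inc_apply s x x"
    using assms unfolding multiplicative_def by blast+
  then show ?thesis by simp
qed

lemma psi_munit:
  fixes s :: "('x::locally_finite_order, 'k::field) incidence_algebra"
  assumes l: "l \<in> poset_Aut"
  shows "(mult_aut s \<circ> hat l) (munit x y) = inc_scale (inc_apply s (l x) (l y)) (munit (l x) (l y))"
proof (rule inc_eqI)
  fix u v
  have b: "bij l" and le: "l x \<le> l y \<longleftrightarrow> x \<le> y" using l by (auto simp: poset_Aut_def)
  have inv: "inv l w = z \<longleftrightarrow> w = l z" for w z using b by (metis bij_inv_eq_iff)
  show "inc_apply ((mult_aut s \<circ> hat l) (munit x y)) u v =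
      inc_apply (inc_scale (inc_apply s (l x) (l y)) (munit (l x) (l y))) u v"
    by (auto simp: mult_aut.rep_eq inc_apply_hat[OF l] munit.rep_eq inc_scale.rep_eq inv le)
qed

lemma psi_munit_diag:
  fixes s :: "('x::locally_finite_order, 'k::field) incidence_algebra"
  assumes "multiplicative s" "l \<in> poset_Aut"
  shows "(mult_aut s \<circ> hat l) (munit x x) = munit (l x) (l x)"
  unfolding psi_munit[OF assms(2)]
  by (rule inc_eqI) (simp add: inc_scale.rep_eq multiplicative_diag[OF assms(1)])


section \<open>The space of twisted derivations\<close>

lemma Der_add:
  assumes "d \<in> Der scale psi" "d' \<in> Der scale psi"
  shows "d + d' \<in> Der scale psi"
  using assms unfolding Der_def Vector_Spaces.linear_iff
  by (auto simp: algebra_simps vector_space.vector_space_assms)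

lemma Der_diff:
  assumes "d \<in> Der scale psi" "d' \<in> Der scale psi"
  shows "d - d' \<in> Der scale psi"
  using assms unfolding Der_def Vector_Spaces.linear_iff
  by (auto simp: algebra_simps module.scale_right_diff_distrib module_iff_vector_space)


section \<open>Splitting off an inner derivation\<close>

text \<open>The element witnessing innerness is assembled columnwise; it is an element of the incidence
  algebra because each of its columns is a column of some \<open>d (munit v v)\<close>.\<close>

lemma inner_der_agrees_on_idempotents:
  fixes d psi :: "('x::locally_finite_order, 'k::field) incidence_algebra \<Rightarrow> ('x, 'k) incidence_algebra"
  assumes d: "d \<in> Der inc_scale psi"
    and psi: "\<And>x. psi (munit x x) = munit (l x) (l x)"
  obtains a where "\<And>x. inner_der psi a (munit x x) = d (munit x x)"
proof -
  have lin: "Vector_Spaces.linear inc_scale inc_scale d"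
    and prod: "d (f * g) = d f * g + psi f * d g" for f g
    using d by (auto simp: Der_def)
  interpret D: Vector_Spaces.linear inc_scale inc_scale d by (rule lin)
  define a :: "('x, 'k) incidence_algebra" where "a = Inc (\<lambda>u v. inc_apply (d (munit v v)) u v)"
  have a: "inc_apply a u v = inc_apply (d (munit v v)) u v" for u v
    unfolding a_def by (subst Inc_inverse) (auto simp: inc_apply_outside)
  \<comment> \<open>\<open>d e\<^sub>x\<close> is the sum of its column \<open>x\<close> and its row \<open>l x\<close>.  At the crossing point \<open>(l x, x)\<close> the
    entry equals twice itself and is therefore 0, in every characteristic.\<close>
  have cross: "inc_apply (d (munit x x)) u v =
      (if v = x then inc_apply (d (munit x x)) u x else 0) +
      (if u = l x then inc_apply (d (munit x x)) (l x) v else 0)" for x u v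
  proof -
    have "d (munit x x) = d (munit x x) * munit x x + munit (l x) (l x) * d (munit x x)"
      using prod[of "munit x x" "munit x x"] by (simp add: munit_diag_mult psi)
    from this[THEN arg_cong, of "\<lambda>f. inc_apply f u v"] show ?thesis
      by (simp add: plus_incidence_algebra.rep_eq times_munit munit_times)
  qed
  \<comment> \<open>Makes row \<open>l x\<close> of \<open>a\<close>, which mixes entries of different \<open>d e\<^sub>v\<close>, match the row of \<open>d e\<^sub>x\<close>.\<close>
  have anti: "inc_apply (d (munit x x)) (l x) v = - inc_apply (d (munit v v)) (l x) v"
    if "x \<noteq> v" for x v
  proof -
    have "0 = d (munit x x) * munit v v + munit (l x) (l x) * d (munit v v)"
      using prod[of "munit x x" "munit v v"] that by (simp add: munit_diag_mult psi D.zero)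
    from this[THEN arg_cong, of "\<lambda>f. inc_apply f (l x) v"] show ?thesis
      by (simp add: plus_incidence_algebra.rep_eq zero_incidence_algebra.rep_eq
          times_munit munit_times eq_neg_iff_add_eq_0)
  qed
  have "inner_der psi a (munit x x) = d (munit x x)" for x
  proof (rule inc_eqI)
    fix u v
    show "inc_apply (inner_der psi a (munit x x)) u v = inc_apply (d (munit x x)) u v"
      using cross[of x u v] anti[of x v]
      by (auto simp: inner_der_def psi minus_incidence_algebra.rep_eq times_munit munit_times a
          split: if_splits)
  qed
  then show ?thesis by (rule that)
qed


section \<open>Twisted derivations vanishing on the idempotents\<close>

text \<open>The coefficient \<open>t(x,y)\<close> can only be the entry at \<open>(l x, y)\<close> of the image of the matrix unit at
  \<open>(x,y)\<close>; its additivity is the product rule for the factorisation of the matrix unit at \<open>(x,z)\<close>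
  through \<open>y\<close>.\<close>

lemma Der_killing_idempotents_in_ADer:
  fixes s :: "('x::locally_finite_order, 'k::field) incidence_algebra"
  assumes s: "multiplicative s" and l: "l \<in> poset_Aut"
    and d: "d \<in> Der inc_scale (mult_aut s \<circ> hat l)"
    and kill: "\<And>x. d (munit x x) = 0"
  shows "d \<in> ADer s l"
proof -
  define psi where "psi = mult_aut s \<circ> hat l"
  have lin: "Vector_Spaces.linear inc_scale inc_scale d"
    and prod: "d (f * g) = d f * g + psi f * d g" for f g
    using d by (auto simp: Der_def psi_def)
  interpret D: Vector_Spaces.linear inc_scale inc_scale d by (rule lin)
  define t :: "('x, 'k) incidence_algebra"
    where "t = Inc (\<lambda>x y. inc_apply (d (munit x y)) (l x) y)"
  have munit0: "munit x y = (0 :: ('x, 'k) incidence_algebra)" if "\<not> x \<le> y" for x y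
    using that by (intro inc_eqI) (simp add: munit.rep_eq zero_incidence_algebra.rep_eq)
  have t: "inc_apply t x y = inc_apply (d (munit x y)) (l x) y" for x y
    unfolding t_def
    by (subst Inc_inverse) (auto simp: munit0 D.zero zero_incidence_algebra.rep_eq)
  have entry: "inc_apply (d f) (l x) y = inc_apply t x y * inc_apply f x y" for f x y
  proof -
    have "d (munit x x * f * munit y y) = munit (l x) (l x) * d f * munit y y"
      by (simp add: prod kill psi_def psi_munit_diag[OF s l, unfolded comp_def] mult.assoc)
    then have "inc_scale (inc_apply f x y) (d (munit x y)) = munit (l x) (l x) * d f * munit y y"
      by (simp add: munit_sandwich D.scale)
    from this[THEN arg_cong, of "\<lambda>g. inc_apply g (l x) y"] show ?thesis
      by (simp add: inc_scale.rep_eq times_munit munit_times t mult.commute)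
  qed
  have additive: "additive_elem s l t"
    unfolding additive_elem_def
  proof (intro conjI allI impI)
    show "inc_apply t x y = 0" if "\<not> l x \<le> y" for x y
      using that by (simp add: t inc_apply_outside)
  next
    fix x y z :: 'x
    assume "x \<le> y \<and> y \<le> z"
    then have le: "x \<le> y" "y \<le> z" and lle: "l x \<le> l y"
      using l by (auto simp: poset_Aut_def)
    have "d (munit x z) = d (munit x y) * munit y z
        + inc_scale (inc_apply s (l x) (l y)) (munit (l x) (l y)) * d (munit y z)"
      using prod[of "munit x y" "munit y z"] le
      by (simp add: munit_mult psi_def psi_munit[OF l, unfolded comp_def])
    from this[THEN arg_cong, of "\<lambda>g. inc_apply g (l x) z"]
    show "inc_apply t x z = inc_apply t x y + inc_apply s (l x) (l y) * inc_apply t y z"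
      using le lle by (simp add: t plus_incidence_algebra.rep_eq inc_scale_mult inc_scale.rep_eq
          times_munit munit_times)
  qed
  have "d = L_map l t"
  proof (rule ext, rule inc_eqI)
    fix f u v
    have "surj l" using l by (auto simp: poset_Aut_def bij_is_surj)
    then obtain x where "u = l x" by (rule surjE)
    then show "inc_apply (d f) u v = inc_apply (L_map l t f) u v"
      by (simp add: entry inc_apply_L_map[OF l additive])
  qed
  with d additive show ?thesis by (auto simp: ADer_def)
qed


section \<open>The decomposition\<close>

theorem theorem2p8:
  fixes s :: "('x::locally_finite_order, 'k::field) incidence_algebra"
    and l :: "'x \<Rightarrow> 'x"
    and psi :: "('x, 'k) incidence_algebra \<Rightarrow> ('x, 'k) incidence_algebra"
  assumes "multiplicative s"
    and "l \<in> poset_Aut"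
    and "psi = mult_aut s \<circ> hat l"
  shows "Der inc_scale psi = IDer psi + ADer s l"
proof
  have IDer: "IDer psi \<subseteq> Der inc_scale psi"
    unfolding assms(3) by (intro IDer_subset_Der psi_in_Aut assms)
  have ADer: "ADer s l \<subseteq> Der inc_scale psi"
    by (auto simp: ADer_def assms(3))
  show "IDer psi + ADer s l \<subseteq> Der inc_scale psi"
    using IDer ADer by (auto elim!: set_plus_elim intro!: Der_add)
  show "Der inc_scale psi \<subseteq> IDer psi + ADer s l"
  proof
    fix d assume d: "d \<in> Der inc_scale psi"
    obtain a where a: "\<And>x. inner_der psi a (munit x x) = d (munit x x)"
      using inner_der_agrees_on_idempotents[OF d, of l] psi_munit_diag[OF assms(1,2)] assms(3)
      by blast
    have inner: "inner_der psi a \<in> IDer psi" by (auto simp: IDer_def)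
    have "d - inner_der psi a \<in> ADer s l"
    proof (rule Der_killing_idempotents_in_ADer[OF assms(1,2)])
      show "d - inner_der psi a \<in> Der inc_scale (mult_aut s \<circ> hat l)"
        using Der_diff[OF d] IDer inner by (auto simp: assms(3))
      show "(d - inner_der psi a) (munit x x) = 0" for x by (simp add: a)
    qed
    with inner have "inner_der psi a + (d - inner_der psi a) \<in> IDer psi + ADer s l"
      by (rule set_plus_intro)
    then show "d \<in> IDer psi + ADer s l" by simp
  qed
qed

end
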